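(* Let $\delta$ be a matrix of free polynomials in $d$ variables with $\delta(0)=0$, and let $f$ be an nc function on $B_\delta$. If there exists $x_0\in B_\delta$ such that $$\|f(x_0)\|\ge\|f(x)\|\quad\text{for all }x\in B_\delta,$$ then $f$ is a constant nc function, i.e. there exists $c\in\mathbb{C}$ such that $f(x)=cI_n$ for all $n\ge1$ and all $x\in(B_\delta)_n$.
   Context: Let $\mathbb{M}_n$ be the $n\times n$ complex matrices (with operator norm), $\mathbb{M}_n^d$ the $d$-tuples of $n\times n$ complex matrices, $\mathbb{M}^d=\coprod_{n\ge1}\mathbb{M}_n^d$ and $\mathbb{M}=\mathbb{M}^1$. A free polynomial in $d$ variables is an element of $\mathbb{C}\langle x_1,\dots,x_d\rangle$; it is evaluated on $x\in\mathbb{M}_n^d$ in the usual way to give an element of $\mathbb{M}_n$. If $\delta$ is an $s\times r$ matrix of free polynomials and $x\in\mathbb{M}_n^d$, then $\delta(x)$ is the $s\times r$ block matrix with $n\times n$ blocks obtained by entrywise evaluation, and $\|\delta(x)\|$ is its operator norm. Define $B_\delta=\{x\in\mathbb{M}^d: \|\delta(x)\|<1\}$ and $(B_\delta)_n=B_\delta\cap\mathbb{M}_n^d$. Here $0$ denotes the zero tuple in any $\mathbb{M}_n^d$. For $\Omega\subset\mathbb{M}^d$ closed under direct sums, with $\Omega_n=\Omega\cap\mathbb{M}_n^d$, a function $f:\Omega\to\mathbb{M}$ is an nc function if it is graded ($f(x)\in\mathbb{M}_n$ whenever $x\in\Omega_n$) and, whenever $x\in\Omega_n$, $y\in\Omega_m$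 and an $m\times n$ matrix $\alpha$ satisfy $\alpha x=y\alpha$ (componentwise), then $\alpha f(x)=f(y)\alpha$. The points $x_0$ and $x$ may lie in different levels $(B_\delta)_n$. *)

theory Defs
  imports "HOL-Analysis.L2_Norm" "HOL-Library.Poly_Mapping" "Jordan_Normal_Form.Matrix"
begin

text \<open>A point of \<open>M\<^sup>d\<close> at level \<open>n\<close> is a list of \<open>d\<close> complex \<open>n \<times> n\<close> matrices. For \<open>d \<ge> 1\<close> the level
  can be read off from the list, so the levels are pairwise disjoint.\<close>

definition nc_level :: "nat \<Rightarrow> nat \<Rightarrow> complex mat list set" where
  "nc_level d n = {x. length x = d \<and> set x \<subseteq> carrier_mat n n}"

definition zero_tuple :: "nat \<Rightarrow> nat \<Rightarrow> complex mat list" where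
  "zero_tuple d n = replicate d (0\<^sub>m n n)"

text \<open>Operator norm with respect to the Euclidean norms.\<close>

definition vec_norm2 :: "complex vec \<Rightarrow> real" where
  "vec_norm2 v = L2_set (\<lambda>i. cmod (v $ i)) {..<dim_vec v}"

definition op_norm :: "complex mat \<Rightarrow> real" where
  "op_norm A = (SUP v\<in>{v \<in> carrier_vec (dim_col A). vec_norm2 v \<le> 1}. vec_norm2 (A *\<^sub>v v))"

text \<open>A free polynomial is a finitely supported family of coefficients indexed by words; the letter
  \<open>i\<close> stands for the variable with (zero-based) index \<open>i\<close>.\<close>

type_synonym free_poly = "nat list \<Rightarrow>\<^sub>0 complex"

definition free_polys :: "nat \<Rightarrow> free_poly set" where
  "free_polys d = {p. \<forall>w\<in>Poly_Mapping.keys p. set w \<subseteq> {..<d}}"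

definition eval_word :: "nat \<Rightarrow> nat list \<Rightarrow> complex mat list \<Rightarrow> complex mat" where
  "eval_word n w x = foldr (\<lambda>i A. x ! i * A) w (1\<^sub>m n)"

text \<open>The sum over the support is taken entrywise, since matrices of varying size do not form an
  instance of \<open>comm_monoid_add\<close>.\<close>

definition eval_poly :: "nat \<Rightarrow> free_poly \<Rightarrow> complex mat list \<Rightarrow> complex mat" where
  "eval_poly n p x = mat n n (\<lambda>(i, j).
     \<Sum>w\<in>Poly_Mapping.keys p. Poly_Mapping.lookup p w * eval_word n w x $$ (i, j))"

text \<open>The block matrix whose block in position \<open>(i, j)\<close> is the evaluation of the corresponding
  entry.\<close>

definition eval_poly_mat :: "nat \<Rightarrow> free_poly mat \<Rightarrow> complex mat list \<Rightarrow> complex mat" where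
  "eval_poly_mat n \<delta> x = mat (dim_row \<delta> * n) (dim_col \<delta> * n) (\<lambda>(i, j).
     eval_poly n (\<delta> $$ (i div n, j div n)) x $$ (i mod n, j mod n))"

definition B_delta :: "nat \<Rightarrow> free_poly mat \<Rightarrow> complex mat list set" where
  "B_delta d \<delta> = (\<Union>n\<in>{1..}. {x \<in> nc_level d n. op_norm (eval_poly_mat n \<delta> x) < 1})"

text \<open>Only the values of \<open>f\<close> on \<open>\<Omega>\<close> matter. Closure of \<open>\<Omega>\<close> under direct sums is a condition on the
  domain, not on \<open>f\<close>, and is not part of this predicate; the sets \<open>B_delta d \<delta>\<close> have it.\<close>

definition nc_function :: "nat \<Rightarrow> complex mat list set \<Rightarrow> (complex mat list \<Rightarrow> complex mat) \<Rightarrow> bool" where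
  "nc_function d \<Omega> f \<longleftrightarrow>
     (\<forall>n\<ge>1. \<forall>x \<in> \<Omega> \<inter> nc_level d n. f x \<in> carrier_mat n n) \<and>
     (\<forall>n\<ge>1. \<forall>m\<ge>1. \<forall>x \<in> \<Omega> \<inter> nc_level d n. \<forall>y \<in> \<Omega> \<inter> nc_level d m. \<forall>\<alpha> \<in> carrier_mat m n.
        (\<forall>i<d. \<alpha> * x ! i = y ! i * \<alpha>) \<longrightarrow> \<alpha> * f x = f y * \<alpha>)"

end

(* Put c = f(0). For an idempotent 2 x 2 matrix P = a b^T and x in B_delta, delta(0) = 0 gives
   delta(x (x) P) = delta(x) (x) P, so y = x (x) P stays in B_delta as soon as |a| |b| is close to 1.
   Intertwining y with x and with 0 gives f(y) = f(x) (x) P + c (1 - P). Let M = |f(x0)|.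
   For P = [[0, e], [0, 1]] and x = x0, |f(y)| <= M yields
   |f(x0) w|^2 + e^2 |(f(x0) - c) w|^2 <= M^2 |w|^2 for every w, which forces |c| = M.
   For P = [[1, e], [0, 0]] and any x it yields |c w|^2 + e^2 |(f(x) - c) w|^2 <= M^2 |w|^2 = |c w|^2,
   hence f(x) = c. *)

theory Submission
  imports Defs
begin

text \<open>Vectors of length \<open>2 * n\<close> stand for elements of C^n \<otimes> C^2 with C^2
  as the inner factor. Summing over both factors then means pairing each even index with its odd
  successor.\<close>

lemma sum_lessThan_double:
  fixes g :: "nat \<Rightarrow> 'a::comm_monoid_add"
  shows "(\<Sum>i<2 * n. g i) = (\<Sum>i<n. g (2 * i) + g (2 * i + 1))"
  by (induction n) (auto simp: add.assoc)

section \<open>The Euclidean norm and the operator norm\<close>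

lemma vec_norm2_nonneg [simp]: "0 \<le> vec_norm2 v"
  by (simp add: vec_norm2_def)

lemma vec_norm2_power2: "(vec_norm2 v)\<^sup>2 = (\<Sum>i<dim_vec v. (cmod (v $ i))\<^sup>2)"
  by (simp add: vec_norm2_def L2_set_def sum_nonneg)

lemma vec_norm2_zero [simp]: "vec_norm2 (0\<^sub>v n) = 0"
  by (simp add: vec_norm2_def L2_set_def)

lemma vec_norm2_eq_0D: "v \<in> carrier_vec n \<Longrightarrow> vec_norm2 v = 0 \<Longrightarrow> v = 0\<^sub>v n"
  by (auto simp: vec_norm2_def L2_set_eq_0_iff)

lemma vec_norm2_smult: "vec_norm2 (c \<cdot>\<^sub>v v) = cmod c * vec_norm2 v"
  by (simp add: vec_norm2_def norm_mult L2_set_right_distrib cong: L2_set_cong_simp)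

lemma vec_norm2_triangle:
  assumes "u \<in> carrier_vec n" "v \<in> carrier_vec n"
  shows "vec_norm2 (u + v) \<le> vec_norm2 u + vec_norm2 v"
proof -
  have "vec_norm2 (u + v) \<le> L2_set (\<lambda>i. cmod (u $ i) + cmod (v $ i)) {..<n}"
    unfolding vec_norm2_def using assms by (auto intro!: L2_set_mono norm_triangle_ineq)
  also have "\<dots> \<le> vec_norm2 u + vec_norm2 v"
    unfolding vec_norm2_def using assms by (auto intro: order_trans[OF L2_set_triangle_ineq])
  finally show ?thesis .
qed

lemma cmod_nth_le_vec_norm2: "i < dim_vec v \<Longrightarrow> cmod (v $ i) \<le> vec_norm2 v"
  unfolding vec_norm2_def by (rule member_le_L2_set) auto

text \<open>A real \<open>SUP\<close> is informative only for bounded sets. Coordinates of a vector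
  in the unit ball have modulus at most 1, so the sum of the moduli of all entries is a crude
  bound.\<close>

lemma bdd_above_mult_mat_vec:
  "bdd_above ((\<lambda>v. vec_norm2 (A *\<^sub>v v)) ` {v \<in> carrier_vec (dim_col A). vec_norm2 v \<le> 1})"
proof (rule bdd_aboveI2)
  fix v assume v: "v \<in> {v \<in> carrier_vec (dim_col A). vec_norm2 v \<le> 1}"
  have "vec_norm2 (A *\<^sub>v v) \<le> (\<Sum>i<dim_row A. cmod ((A *\<^sub>v v) $ i))"
    unfolding vec_norm2_def by (auto intro: order_trans[OF L2_set_le_sum])
  also have "\<dots> \<le> (\<Sum>i<dim_row A. \<Sum>j<dim_col A. cmod (A $$ (i, j)))"
  proof (rule sum_mono)
    fix i assume i: "i \<in> {..<dim_row A}"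
    have "cmod ((A *\<^sub>v v) $ i) = cmod (\<Sum>j<dim_col A. A $$ (i, j) * v $ j)"
      using i v by (auto simp: scalar_prod_def atLeast0LessThan intro!: arg_cong[of _ _ cmod] sum.cong)
    also have "\<dots> \<le> (\<Sum>j<dim_col A. cmod (A $$ (i, j)) * 1)"
    proof (rule sum_norm_le)
      fix j assume "j \<in> {..<dim_col A}"
      then have "cmod (v $ j) \<le> 1"
        using v cmod_nth_le_vec_norm2[of j v] by auto
      then show "cmod (A $$ (i, j) * v $ j) \<le> cmod (A $$ (i, j)) * 1"
        unfolding norm_mult by (intro mult_left_mono) auto
    qed
    finally show "cmod ((A *\<^sub>v v) $ i) \<le> (\<Sum>j<dim_col A. cmod (A $$ (i, j)))" by simp
  qed
  finally show "vec_norm2 (A *\<^sub>v v) \<le> (\<Sum>i<dim_row A. \<Sum>j<dim_col A. cmod (A $$ (i, j)))" .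
qed

lemma op_norm_least:
  assumes "\<And>v. v \<in> carrier_vec (dim_col A) \<Longrightarrow> vec_norm2 v \<le> 1 \<Longrightarrow> vec_norm2 (A *\<^sub>v v) \<le> K"
  shows "op_norm A \<le> K"
proof -
  \<comment> \<open>\<open>cSUP_least\<close> asks for a nonempty index set; the zero vector lies in
    the unit ball in every dimension, including 0.\<close>
  have "0\<^sub>v (dim_col A) \<in> {v \<in> carrier_vec (dim_col A). vec_norm2 v \<le> 1}"
    by simp
  then show ?thesis
    unfolding op_norm_def by (intro cSUP_least) (use assms in blast)+
qed

lemma vec_norm2_mult_mat_vec_le:
  assumes v: "v \<in> carrier_vec (dim_col A)"
  shows "vec_norm2 (A *\<^sub>v v) \<le> op_norm A * vec_norm2 v"
proof (cases "vec_norm2 v = 0")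
  case True
  then have "A *\<^sub>v v = 0\<^sub>v (dim_row A)"
    using vec_norm2_eq_0D[OF v] by auto
  then show ?thesis using True by simp
next
  case False
  \<comment> \<open>Homogeneity: the supremum bounds the image of the normalised vector
    \<open>u\<close>, and scaling back by \<open>t\<close> gives the claim.\<close>
  define t where "t = vec_norm2 v"
  have t: "t > 0" using False vec_norm2_nonneg[of v] unfolding t_def by linarith
  define u where "u = complex_of_real (1 / t) \<cdot>\<^sub>v v"
  have "vec_norm2 u = 1"
    unfolding u_def vec_norm2_smult t_def[symmetric] norm_of_real using t by simp
  then have "vec_norm2 (A *\<^sub>v u) \<le> op_norm A"
    unfolding op_norm_def using v by (intro cSUP_upper bdd_above_mult_mat_vec) (auto simp: u_def)
  also have "A *\<^sub>v u = complex_of_real (1 / t) \<cdot>\<^sub>v (A *\<^sub>v v)"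
    unfolding u_def using v by (intro mult_mat_vec) auto
  finally show ?thesis
    using t by (simp add: vec_norm2_smult t_def norm_divide field_simps)
qed

lemma op_norm_nonneg [simp]: "0 \<le> op_norm A"
proof -
  have "vec_norm2 (A *\<^sub>v 0\<^sub>v (dim_col A)) \<le> op_norm A"
    unfolding op_norm_def by (intro cSUP_upper bdd_above_mult_mat_vec) auto
  then show ?thesis using vec_norm2_nonneg order_trans by blast
qed

lemma op_norm_zero_mat [simp]: "op_norm (0\<^sub>m m n) = 0"
proof (rule antisym)
  show "op_norm (0\<^sub>m m n) \<le> 0"
  proof (rule op_norm_least)
    fix v :: "complex vec" assume "v \<in> carrier_vec (dim_col (0\<^sub>m m n))"
    then have "0\<^sub>m m n *\<^sub>v v = 0\<^sub>v m" by auto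
    then show "vec_norm2 (0\<^sub>m m n *\<^sub>v v) \<le> 0" by simp
  qed
qed simp

section \<open>Tensoring with C^2 and with rank-one 2 x 2 matrices\<close>

text \<open>This is u \<otimes> (1, 0) + w \<otimes> (0, 1), with the C^2 factor running fastest.
  The length is taken from \<open>u\<close>; \<open>w\<close> is meant to have the same one.\<close>

definition interleave :: "complex vec \<Rightarrow> complex vec \<Rightarrow> complex vec" where
  "interleave u w = vec (2 * dim_vec u) (\<lambda>i. if even i then u $ (i div 2) else w $ (i div 2))"

lemma interleave_carrier [simp]: "u \<in> carrier_vec n \<Longrightarrow> interleave u w \<in> carrier_vec (2 * n)"
  by (auto simp: interleave_def)

lemma interleave_surj:
  assumes "v \<in> carrier_vec (2 * n)"
  obtains u w where "u \<in> carrier_vec n" "w \<in> carrier_vec n" "v = interleave u w"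
proof
  show "v = interleave (vec n (\<lambda>i. v $ (2 * i))) (vec n (\<lambda>i. v $ (2 * i + 1)))"
    using assms by (intro eq_vecI) (auto simp: interleave_def)
qed auto

lemma vec_norm2_interleave:
  assumes "u \<in> carrier_vec n" "w \<in> carrier_vec n"
  shows "(vec_norm2 (interleave u w))\<^sup>2 = (vec_norm2 u)\<^sup>2 + (vec_norm2 w)\<^sup>2"
proof -
  have "(vec_norm2 (interleave u w))\<^sup>2 = (\<Sum>i<2 * n. (cmod (interleave u w $ i))\<^sup>2)"
    using assms by (simp add: vec_norm2_power2 interleave_def)
  also have "\<dots> = (\<Sum>i<n. (cmod (u $ i))\<^sup>2 + (cmod (w $ i))\<^sup>2)"
    unfolding sum_lessThan_double using assms by (intro sum.cong) (auto simp: interleave_def)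
  also have "\<dots> = (vec_norm2 u)\<^sup>2 + (vec_norm2 w)\<^sup>2"
    using assms by (simp add: vec_norm2_power2 sum.distrib)
  finally show ?thesis .
qed

text \<open>The Kronecker product \<open>A \<otimes> a b\<^sup>T\<close> with \<open>a = (a\<^sub>0, a\<^sub>1)\<close> and \<open>b = (b\<^sub>0, b\<^sub>1)\<close>. The small factor is
  the inner one, so that the operation commutes with forming the block matrix \<open>\<delta>(x)\<close>.\<close>

definition kron_rank1 :: "complex \<Rightarrow> complex \<Rightarrow> complex \<Rightarrow> complex \<Rightarrow> complex mat \<Rightarrow> complex mat" where
  "kron_rank1 a0 a1 b0 b1 A = mat (2 * dim_row A) (2 * dim_col A)
     (\<lambda>(i, j). (if even i then a0 else a1) * A $$ (i div 2, j div 2) * (if even j then b0 else b1))"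

lemma kron_rank1_carrier [simp]:
  "A \<in> carrier_mat m n \<Longrightarrow> kron_rank1 a0 a1 b0 b1 A \<in> carrier_mat (2 * m) (2 * n)"
  by (auto simp: kron_rank1_def)

lemma kron_rank1_dim [simp]:
  "dim_row (kron_rank1 a0 a1 b0 b1 A) = 2 * dim_row A"
  "dim_col (kron_rank1 a0 a1 b0 b1 A) = 2 * dim_col A"
  by (auto simp: kron_rank1_def)

text \<open>With P = a b^T, the product is A B \<otimes> P^2, and b^T a = 1 makes P
  idempotent.\<close>

lemma kron_rank1_mult:
  assumes "A \<in> carrier_mat m n" "B \<in> carrier_mat n k" "a0 * b0 + a1 * b1 = 1"
  shows "kron_rank1 a0 a1 b0 b1 A * kron_rank1 a0 a1 b0 b1 B = kron_rank1 a0 a1 b0 b1 (A * B)"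
proof (rule eq_matI)
  fix i j
  assume "i < dim_row (kron_rank1 a0 a1 b0 b1 (A * B))" "j < dim_col (kron_rank1 a0 a1 b0 b1 (A * B))"
  then have i: "i < 2 * m" "i div 2 < m" and j: "j < 2 * k" "j div 2 < k"
    using assms by auto
  let ?a = "if even i then a0 else a1" and ?b = "if even j then b0 else b1"
  have "(kron_rank1 a0 a1 b0 b1 A * kron_rank1 a0 a1 b0 b1 B) $$ (i, j)
      = (\<Sum>l<2 * n. kron_rank1 a0 a1 b0 b1 A $$ (i, l) * kron_rank1 a0 a1 b0 b1 B $$ (l, j))"
    using assms i j by (auto simp: scalar_prod_def atLeast0LessThan intro!: sum.cong)
  also have "\<dots> = (\<Sum>l<n. (a0 * b0 + a1 * b1) * (?a * (A $$ (i div 2, l) * B $$ (l, j div 2)) * ?b))"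
    unfolding sum_lessThan_double
    using assms(1,2) i j by (intro sum.cong) (auto simp: kron_rank1_def algebra_simps)
  also have "\<dots> = ?a * (\<Sum>l<n. A $$ (i div 2, l) * B $$ (l, j div 2)) * ?b"
    unfolding assms(3) by (simp add: sum_distrib_left sum_distrib_right)
  also have "(\<Sum>l<n. A $$ (i div 2, l) * B $$ (l, j div 2)) = (A * B) $$ (i div 2, j div 2)"
    using assms i j by (auto simp: scalar_prod_def atLeast0LessThan intro!: sum.cong)
  also have "?a * (A * B) $$ (i div 2, j div 2) * ?b = kron_rank1 a0 a1 b0 b1 (A * B) $$ (i, j)"
    using assms i j by (simp add: kron_rank1_def)
  finally show "(kron_rank1 a0 a1 b0 b1 A * kron_rank1 a0 a1 b0 b1 B) $$ (i, j)
      = kron_rank1 a0 a1 b0 b1 (A * B) $$ (i, j)" .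
qed (use assms in auto)

text \<open>The factor b^T first contracts C^2 and leaves a vector of C^n, then A acts on it, and
  finally a spreads the result over C^2 again.\<close>

lemma kron_rank1_mult_vec:
  assumes "A \<in> carrier_mat m n" "u \<in> carrier_vec n" "w \<in> carrier_vec n"
  shows "kron_rank1 a0 a1 b0 b1 A *\<^sub>v interleave u w
    = interleave (a0 \<cdot>\<^sub>v (A *\<^sub>v (b0 \<cdot>\<^sub>v u + b1 \<cdot>\<^sub>v w))) (a1 \<cdot>\<^sub>v (A *\<^sub>v (b0 \<cdot>\<^sub>v u + b1 \<cdot>\<^sub>v w)))"
    (is "?L = ?R")
proof (rule eq_vecI)
  fix i assume "i < dim_vec ?R"
  then have i: "i < 2 * m" "i div 2 < m" using assms by (auto simp: interleave_def)
  let ?a = "if even i then a0 else a1"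
  have "?L $ i = (\<Sum>l<2 * n. kron_rank1 a0 a1 b0 b1 A $$ (i, l) * interleave u w $ l)"
    using assms i by (auto simp: scalar_prod_def interleave_def atLeast0LessThan intro!: sum.cong)
  also have "\<dots> = (\<Sum>l<n. ?a * (A $$ (i div 2, l) * (b0 * u $ l + b1 * w $ l)))"
    unfolding sum_lessThan_double
    using assms i by (intro sum.cong) (auto simp: kron_rank1_def interleave_def algebra_simps)
  also have "\<dots> = ?a * (\<Sum>l<n. A $$ (i div 2, l) * (b0 * u $ l + b1 * w $ l))"
    by (simp add: sum_distrib_left)
  also have "(\<Sum>l<n. A $$ (i div 2, l) * (b0 * u $ l + b1 * w $ l))
      = (A *\<^sub>v (b0 \<cdot>\<^sub>v u + b1 \<cdot>\<^sub>v w)) $ (i div 2)"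
    using assms i by (auto simp: scalar_prod_def atLeast0LessThan intro!: sum.cong)
  also have "?a * \<dots> = ?R $ i"
    using assms i by (auto simp: interleave_def)
  finally show "?L $ i = ?R $ i" .
qed (use assms in \<open>auto simp: interleave_def\<close>)

text \<open>The square root is |a| |b|, the norm of P = a b^T. Contracting with b^T costs at most
  |b|, applying A costs \<open>op_norm A\<close>, and tensoring with a costs exactly |a|.\<close>

lemma op_norm_kron_rank1:
  "op_norm (kron_rank1 a0 a1 b0 b1 A)
    \<le> sqrt (((cmod a0)\<^sup>2 + (cmod a1)\<^sup>2) * ((cmod b0)\<^sup>2 + (cmod b1)\<^sup>2)) * op_norm A"
proof (rule op_norm_least)
  let ?a = "(cmod a0)\<^sup>2 + (cmod a1)\<^sup>2" and ?b = "(cmod b0)\<^sup>2 + (cmod b1)\<^sup>2"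
  fix v assume "v \<in> carrier_vec (dim_col (kron_rank1 a0 a1 b0 b1 A))" and v1: "vec_norm2 v \<le> 1"
  then obtain u w where u: "u \<in> carrier_vec (dim_col A)" and w: "w \<in> carrier_vec (dim_col A)"
    and v: "v = interleave u w"
    using interleave_surj[of v "dim_col A"] by auto
  have A: "A \<in> carrier_mat (dim_row A) (dim_col A)" by simp
  define z where "z = b0 \<cdot>\<^sub>v u + b1 \<cdot>\<^sub>v w"
  have z: "z \<in> carrier_vec (dim_col A)" using u w by (simp add: z_def)
  have "vec_norm2 z \<le> cmod b0 * vec_norm2 u + cmod b1 * vec_norm2 w"
    unfolding z_def using vec_norm2_triangle[of "b0 \<cdot>\<^sub>v u" _ "b1 \<cdot>\<^sub>v w"] u w
    by (simp add: vec_norm2_smult)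
  then have "(vec_norm2 z)\<^sup>2 \<le> (cmod b0 * vec_norm2 u + cmod b1 * vec_norm2 w)\<^sup>2"
    by (intro power_mono) auto
  \<comment> \<open>Cauchy-Schwarz in two dimensions: by Lagrange's identity the two sides differ by
    the square supplied below.\<close>
  also have "\<dots> \<le> ?b * ((vec_norm2 u)\<^sup>2 + (vec_norm2 w)\<^sup>2)"
    using zero_le_power2[of "cmod b0 * vec_norm2 w - cmod b1 * vec_norm2 u"]
    by (simp add: power2_eq_square algebra_simps)
  also have "\<dots> = ?b * (vec_norm2 v)\<^sup>2"
    using vec_norm2_interleave[OF u w] v by simp
  also have "\<dots> \<le> ?b * 1"
    using v1 by (intro mult_left_mono power_le_one) auto
  finally have z2: "(vec_norm2 z)\<^sup>2 \<le> ?b" by simp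
  have "(vec_norm2 (kron_rank1 a0 a1 b0 b1 A *\<^sub>v v))\<^sup>2 = ?a * (vec_norm2 (A *\<^sub>v z))\<^sup>2"
  proof -
    have "A *\<^sub>v z \<in> carrier_vec (dim_row A)" by (rule mult_mat_vec_carrier[OF A z])
    then show ?thesis
      unfolding v kron_rank1_mult_vec[OF A u w] z_def[symmetric]
      by (subst vec_norm2_interleave)
        (auto simp: vec_norm2_smult power_mult_distrib distrib_right)
  qed
  also have "\<dots> \<le> ?a * (op_norm A * vec_norm2 z)\<^sup>2"
    using vec_norm2_mult_mat_vec_le[OF z] by (intro mult_left_mono power_mono) auto
  also have "\<dots> \<le> ?a * ((op_norm A)\<^sup>2 * ?b)"
    unfolding power_mult_distrib using z2 by (intro mult_left_mono) auto
  also have "\<dots> = (sqrt (?a * ?b) * op_norm A)\<^sup>2"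
    by (simp add: power_mult_distrib)
  finally show "vec_norm2 (kron_rank1 a0 a1 b0 b1 A *\<^sub>v v) \<le> sqrt (?a * ?b) * op_norm A"
    by (rule power2_le_imp_le) auto
qed

text \<open>The matrix of v \<mapsto> v \<otimes> a, that is, the identity tensored with the column
  a.\<close>

definition embed_mat :: "nat \<Rightarrow> complex \<Rightarrow> complex \<Rightarrow> complex mat" where
  "embed_mat n a0 a1 = mat (2 * n) n
     (\<lambda>(i, j). if i div 2 = j then (if even i then a0 else a1) else 0)"

lemma embed_mat_carrier [simp]: "embed_mat n a0 a1 \<in> carrier_mat (2 * n) n"
  by (simp add: embed_mat_def)

lemma embed_mat_mult_vec:
  assumes "v \<in> carrier_vec n"
  shows "embed_mat n a0 a1 *\<^sub>v v = interleave (a0 \<cdot>\<^sub>v v) (a1 \<cdot>\<^sub>v v)" (is "?L = ?R")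
proof (rule eq_vecI)
  fix i assume "i < dim_vec ?R"
  then have i: "i < 2 * n" "i div 2 < n" using assms by (auto simp: interleave_def)
  have "?L $ i = (\<Sum>l<n. if i div 2 = l then (if even i then a0 else a1) * v $ l else 0)"
    using assms i by (auto simp: embed_mat_def scalar_prod_def atLeast0LessThan
        if_distrib[of "\<lambda>a. a * _"] cong: if_cong)
  also have "\<dots> = ?R $ i"
    using assms i by (auto simp: interleave_def)
  finally show "?L $ i = ?R $ i" .
qed (use assms in \<open>auto simp: embed_mat_def interleave_def\<close>)

lemma eq_mat_by_vec:
  assumes "A \<in> carrier_mat m n" "B \<in> carrier_mat m n"
    and "\<And>v. v \<in> carrier_vec n \<Longrightarrow> A *\<^sub>v v = B *\<^sub>v v"
  shows "A = (B :: complex mat)"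
proof (rule eq_matI)
  fix i j assume "i < dim_row B" "j < dim_col B"
  then show "A $$ (i, j) = B $$ (i, j)"
    using assms(1,2) arg_cong[OF assms(3)[of "unit_vec n j"], of "\<lambda>v. v $ i"] by auto
qed (use assms in auto)

text \<open>Since P a = a (b^T a) = a, the map v \<mapsto> v \<otimes> a intertwines A with A
  \<otimes> P. Applied to every component, this links a point x to x \<otimes> P.\<close>

lemma kron_rank1_mult_embed:
  assumes A: "A \<in> carrier_mat n n" and ab: "a0 * b0 + a1 * b1 = 1"
  shows "kron_rank1 a0 a1 b0 b1 A * embed_mat n a0 a1 = embed_mat n a0 a1 * A"
proof (rule eq_mat_by_vec)
  fix v :: "complex vec" assume v: "v \<in> carrier_vec n"
  have "b0 \<cdot>\<^sub>v (a0 \<cdot>\<^sub>v v) + b1 \<cdot>\<^sub>v (a1 \<cdot>\<^sub>v v) = (a0 * b0 + a1 * b1) \<cdot>\<^sub>v v"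
    using v by (auto simp: algebra_simps)
  then have eq: "b0 \<cdot>\<^sub>v (a0 \<cdot>\<^sub>v v) + b1 \<cdot>\<^sub>v (a1 \<cdot>\<^sub>v v) = v"
    unfolding ab using v by simp
  have "(kron_rank1 a0 a1 b0 b1 A * embed_mat n a0 a1) *\<^sub>v v
      = kron_rank1 a0 a1 b0 b1 A *\<^sub>v interleave (a0 \<cdot>\<^sub>v v) (a1 \<cdot>\<^sub>v v)"
    using assoc_mult_mat_vec[OF kron_rank1_carrier[OF A] embed_mat_carrier v]
    by (simp add: embed_mat_mult_vec[OF v])
  also have "\<dots> = interleave (a0 \<cdot>\<^sub>v (A *\<^sub>v v)) (a1 \<cdot>\<^sub>v (A *\<^sub>v v))"
    using v by (subst kron_rank1_mult_vec[OF A]) (auto simp: eq)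
  also have "\<dots> = (embed_mat n a0 a1 * A) *\<^sub>v v"
    using assoc_mult_mat_vec[OF embed_mat_carrier A v] A v by (simp add: embed_mat_mult_vec)
  finally show "(kron_rank1 a0 a1 b0 b1 A * embed_mat n a0 a1) *\<^sub>v v
      = (embed_mat n a0 a1 * A) *\<^sub>v v" .
qed (rule mult_carrier_mat[OF kron_rank1_carrier[OF A] embed_mat_carrier]
      mult_carrier_mat[OF embed_mat_carrier A])+

section \<open>Evaluating free polynomials at x \<otimes> P\<close>

lemma kron_rank1_in_nc_level:
  "x \<in> nc_level d n \<Longrightarrow> map (kron_rank1 a0 a1 b0 b1) x \<in> nc_level d (2 * n)"
  by (auto simp: nc_level_def intro!: kron_rank1_carrier)

lemma eval_word_carrier:
  assumes "x \<in> nc_level d n" "set w \<subseteq> {..<d}"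
  shows "eval_word n w x \<in> carrier_mat n n"
  using assms(2)
proof (induction w)
  case (Cons i w)
  then have "x ! i \<in> carrier_mat n n" using assms(1) by (auto simp: nc_level_def)
  then show ?case using Cons by (auto simp: eval_word_def)
qed (simp add: eval_word_def)

text \<open>Products of the A \<otimes> P collapse because P is idempotent. The empty word is
  excluded: it evaluates to the identity of size \<open>2 * n\<close>, not to 1 \<otimes> P. So the
  induction starts with single letters.\<close>

lemma eval_word_kron_rank1:
  assumes x: "x \<in> nc_level d n" and ab: "a0 * b0 + a1 * b1 = 1"
    and "w \<noteq> []" "set w \<subseteq> {..<d}"
  shows "eval_word (2 * n) w (map (kron_rank1 a0 a1 b0 b1) x)
    = kron_rank1 a0 a1 b0 b1 (eval_word n w x)"
  using assms(3,4)
proof (induction w rule: list_nonempty_induct)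
  case (single i)
  then have "i < length x" "x ! i \<in> carrier_mat n n" using x by (auto simp: nc_level_def)
  then show ?case
    using right_mult_one_mat[OF kron_rank1_carrier] by (auto simp: eval_word_def)
next
  case (cons i w)
  then have i: "i < length x" "x ! i \<in> carrier_mat n n" using x by (auto simp: nc_level_def)
  have w: "eval_word n w x \<in> carrier_mat n n"
    using cons by (intro eval_word_carrier[OF x]) auto
  show ?case
    using cons i kron_rank1_mult[OF i(2) w ab] by (simp add: eval_word_def)
qed

lemma eval_word_zero_tuple:
  assumes "set w \<subseteq> {..<d}"
  shows "eval_word 1 w (zero_tuple d 1) $$ (0, 0) = (if w = [] then 1 else 0)"
proof (cases w)
  case (Cons i v)
  have "zero_tuple d 1 \<in> nc_level d 1"
    by (auto simp: zero_tuple_def nc_level_def)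
  then have "eval_word 1 v (zero_tuple d 1) \<in> carrier_mat 1 1"
    using assms Cons by (intro eval_word_carrier) auto
  moreover have "eval_word 1 w (zero_tuple d 1) = 0\<^sub>m 1 1 * eval_word 1 v (zero_tuple d 1)"
    using assms Cons by (simp add: eval_word_def zero_tuple_def)
  ultimately show ?thesis using Cons by auto
qed (simp add: eval_word_def)

lemma eval_poly_dim [simp]: "dim_row (eval_poly n p x) = n" "dim_col (eval_poly n p x) = n"
  by (simp_all add: eval_poly_def)

text \<open>Every nonempty word contains a zero factor, so level 1 already recovers the constant
  coefficient. This turns \<delta>(0) = 0 into a condition on coefficients.\<close>

lemma eval_poly_zero_tuple:
  assumes "p \<in> free_polys d"
  shows "eval_poly 1 p (zero_tuple d 1) $$ (0, 0) = Poly_Mapping.lookup p []"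
proof -
  have "eval_poly 1 p (zero_tuple d 1) $$ (0, 0)
      = (\<Sum>w\<in>Poly_Mapping.keys p. Poly_Mapping.lookup p w * (if w = [] then 1 else 0))"
    using assms unfolding eval_poly_def free_polys_def
    by (auto simp: eval_word_zero_tuple[simplified] intro!: sum.cong)
  also have "\<dots> = (\<Sum>w\<in>Poly_Mapping.keys p. if w = [] then Poly_Mapping.lookup p w else 0)"
    by (intro sum.cong) auto
  also have "\<dots> = Poly_Mapping.lookup p []"
    by (simp add: sum.delta in_keys_iff)
  finally show ?thesis .
qed

text \<open>A \<mapsto> A \<otimes> P is linear and compatible with every nonempty word;
  \<open>p0\<close> removes the one remaining word.\<close>

lemma eval_poly_kron_rank1:
  assumes x: "x \<in> nc_level d n" and ab: "a0 * b0 + a1 * b1 = 1"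
    and p: "p \<in> free_polys d" and p0: "Poly_Mapping.lookup p [] = 0"
  shows "eval_poly (2 * n) p (map (kron_rank1 a0 a1 b0 b1) x)
    = kron_rank1 a0 a1 b0 b1 (eval_poly n p x)" (is "?L = ?R")
proof (rule eq_matI)
  fix i j assume "i < dim_row ?R" "j < dim_col ?R"
  then have i: "i < 2 * n" "i div 2 < n" and j: "j < 2 * n" "j div 2 < n"
    by (auto simp: eval_poly_def)
  have *: "eval_word (2 * n) w (map (kron_rank1 a0 a1 b0 b1) x) $$ (i, j)
      = (if even i then a0 else a1) * eval_word n w x $$ (i div 2, j div 2)
        * (if even j then b0 else b1)" if "w \<in> Poly_Mapping.keys p" for w
  proof -
    have "w \<noteq> []" "set w \<subseteq> {..<d}"
      using that p p0 by (auto simp: free_polys_def in_keys_iff)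
    then show ?thesis
      using eval_word_carrier[OF x, of w] i j
      by (subst eval_word_kron_rank1[OF x ab]) (auto simp: kron_rank1_def)
  qed
  show "?L $$ (i, j) = ?R $$ (i, j)"
    using i j unfolding eval_poly_def
    by (simp add: kron_rank1_def * sum_distrib_left sum_distrib_right)
      (auto intro!: sum.cong simp: mult_ac)
qed (auto simp: eval_poly_def)

lemma eval_poly_mat_kron_rank1:
  assumes x: "x \<in> nc_level d n" and ab: "a0 * b0 + a1 * b1 = 1"
    and \<delta>: "elements_mat \<delta> \<subseteq> free_polys d"
    and \<delta>0: "\<And>i j. i < dim_row \<delta> \<Longrightarrow> j < dim_col \<delta> \<Longrightarrow> Poly_Mapping.lookup (\<delta> $$ (i, j)) [] = 0"
  shows "eval_poly_mat (2 * n) \<delta> (map (kron_rank1 a0 a1 b0 b1) x)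
    = kron_rank1 a0 a1 b0 b1 (eval_poly_mat n \<delta> x)" (is "?L = ?R")
proof (rule eq_matI)
  fix i j assume "i < dim_row ?R" "j < dim_col ?R"
  then have i: "i < dim_row \<delta> * (2 * n)" "i div 2 < dim_row \<delta> * n"
    and j: "j < dim_col \<delta> * (2 * n)" "j div 2 < dim_col \<delta> * n"
    by (auto simp: eval_poly_mat_def)
  have n: "n > 0" using i by (cases n) auto
  have lt: "i div (2 * n) < dim_row \<delta>" "j div (2 * n) < dim_col \<delta>"
    using i(1) j(1) by (auto intro!: less_mult_imp_div_less)
  \<comment> \<open>Because the C^2 factor is the inner one, halving an index keeps its block:
    blocks of size \<open>2 * n\<close> for x \<otimes> P correspond to blocks of size
    \<open>n\<close> for x, and parity survives reduction inside a block.\<close>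
  have idx: "k div 2 div n = k div (2 * n)" "k div 2 mod n = k mod (2 * n) div 2"
    "even (k mod (2 * n)) = even k" for k :: nat
    by (auto simp: div_mult2_eq mod_mult2_eq dvd_mod_iff)
  have lt': "k mod (2 * n) < 2 * n" for k :: nat
    using n by simp
  have "\<delta> $$ (i div (2 * n), j div (2 * n)) \<in> free_polys d"
    using lt \<delta> by blast
  then show "?L $$ (i, j) = ?R $$ (i, j)"
    using i j lt lt'[of i] lt'[of j] \<delta>0[OF lt]
    by (simp add: eval_poly_mat_def eval_poly_kron_rank1[OF x ab] kron_rank1_def idx)
qed (auto simp: eval_poly_mat_def)


section \<open>Consequences of the intertwining property\<close>

lemma nc_function_carrier:
  assumes "nc_function d \<Omega> f" "n \<ge> 1" "x \<in> \<Omega>" "x \<in> nc_level d n"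
  shows "f x \<in> carrier_mat n n"
  using assms unfolding nc_function_def by blast

lemma nc_function_intertwine:
  assumes "nc_function d \<Omega> f" "n \<ge> 1" "x \<in> \<Omega>" "x \<in> nc_level d n"
    "m \<ge> 1" "y \<in> \<Omega>" "y \<in> nc_level d m"
    and "\<alpha> \<in> carrier_mat m n" "\<And>i. i < d \<Longrightarrow> \<alpha> * x ! i = y ! i * \<alpha>"
  shows "\<alpha> * f x = f y * \<alpha>"
  using assms unfolding nc_function_def by (meson IntI)

text \<open>Read \<open>v\<close> as an m x 1 matrix. It intertwines the zero tuple of level 1 with
  \<open>y\<close>, as both products vanish, so f(y) v = v f(0), where f(0) is a scalar.\<close>

lemma nc_function_on_kernel:
  assumes f: "nc_function d \<Omega> f" and z: "zero_tuple d 1 \<in> \<Omega>"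
    and m: "m \<ge> 1" and y: "y \<in> \<Omega>" "y \<in> nc_level d m"
    and v: "v \<in> carrier_vec m" and yv: "\<And>i. i < d \<Longrightarrow> y ! i *\<^sub>v v = 0\<^sub>v m"
  shows "f y *\<^sub>v v = f (zero_tuple d 1) $$ (0, 0) \<cdot>\<^sub>v v"
proof -
  define \<alpha> where "\<alpha> = mat m 1 (\<lambda>(i, j). v $ i)"
  have \<alpha>: "\<alpha> \<in> carrier_mat m 1" "col \<alpha> 0 = v"
    using v by (auto simp: \<alpha>_def)
  have z': "zero_tuple d 1 \<in> nc_level d 1"
    by (auto simp: zero_tuple_def nc_level_def)
  have fz: "f (zero_tuple d 1) \<in> carrier_mat 1 1" and fy: "f y \<in> carrier_mat m m"
    using nc_function_carrier[OF f _ z z'] nc_function_carrier[OF f m y] by auto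
  have "\<alpha> * zero_tuple d 1 ! i = y ! i * \<alpha>" if i: "i < d" for i
  proof (rule mat_col_eqI)
    have yi: "y ! i \<in> carrier_mat m m" using y i by (auto simp: nc_level_def)
    show "dim_row (\<alpha> * zero_tuple d 1 ! i) = dim_row (y ! i * \<alpha>)"
      "dim_col (\<alpha> * zero_tuple d 1 ! i) = dim_col (y ! i * \<alpha>)"
      using yi \<alpha> i by (auto simp: zero_tuple_def)
    fix j assume "j < dim_col (y ! i * \<alpha>)"
    then have "j = 0" using \<alpha> by auto
    then have "col (y ! i * \<alpha>) j = 0\<^sub>v m"
      using col_mult2[OF yi \<alpha>(1), of 0] \<alpha>(2) yv[OF i] by simp
    moreover have "\<alpha> * zero_tuple d 1 ! i = 0\<^sub>m m 1"
      using \<alpha> i by (simp add: zero_tuple_def)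
    ultimately show "col (\<alpha> * zero_tuple d 1 ! i) j = col (y ! i * \<alpha>) j"
      using \<open>j = 0\<close> by simp
  qed
  then have eq: "\<alpha> * f (zero_tuple d 1) = f y * \<alpha>"
    by (intro nc_function_intertwine[OF f _ z z' m y \<alpha>(1)]) auto
  have "f y *\<^sub>v v = col (\<alpha> * f (zero_tuple d 1)) 0"
    using col_mult2[OF fy \<alpha>(1), of 0] \<alpha>(2) eq by simp
  also have "\<dots> = f (zero_tuple d 1) $$ (0, 0) \<cdot>\<^sub>v v"
    using v fz \<alpha>(1) by (auto simp: \<alpha>_def scalar_prod_def)
  finally show ?thesis .
qed

text \<open>For \<open>b\<^sup>T a = 1\<close> the matrix \<open>P = a b\<^sup>T\<close> is idempotent, so \<open>f (x \<otimes> P) = f(x) \<otimes> P + c (1 - P)\<close>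
  with \<open>c = f(0)\<close>. The inequality compares the norm of this matrix on the vector
  \<open>w \<otimes> (0, 1)\<close> with the bound \<open>M\<close>.\<close>

lemma nc_function_kron_rank1_bound:
  assumes f: "nc_function d (B_delta d \<delta>) f" and z: "zero_tuple d 1 \<in> B_delta d \<delta>"
    and n: "n \<ge> 1" and x: "x \<in> B_delta d \<delta>" "x \<in> nc_level d n"
    and ab: "a0 * b0 + a1 * b1 = 1"
    and y: "map (kron_rank1 a0 a1 b0 b1) x \<in> B_delta d \<delta>"
    and M: "op_norm (f (map (kron_rank1 a0 a1 b0 b1) x)) \<le> M"
    and w: "w \<in> carrier_vec n"
    and c: "c = f (zero_tuple d 1) $$ (0, 0)"
    and D: "D = f x *\<^sub>v w - c \<cdot>\<^sub>v w"
  shows "(cmod (a0 * b1) * vec_norm2 D)\<^sup>2 + (vec_norm2 (c \<cdot>\<^sub>v w + (a1 * b1) \<cdot>\<^sub>v D))\<^sup>2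
    \<le> (M * vec_norm2 w)\<^sup>2"
proof -
  define y where "y = map (kron_rank1 a0 a1 b0 b1) x"
  have yB: "y \<in> B_delta d \<delta>" and yl: "y \<in> nc_level d (2 * n)"
    using assms kron_rank1_in_nc_level by (auto simp: y_def)
  have fx: "f x \<in> carrier_mat n n" and fy: "f y \<in> carrier_mat (2 * n) (2 * n)"
    using nc_function_carrier[OF f] n x yB yl by auto
  have xi: "x ! i \<in> carrier_mat n n" "y ! i = kron_rank1 a0 a1 b0 b1 (x ! i)" if "i < d" for i
    using x that by (auto simp: nc_level_def y_def)
  have D': "D \<in> carrier_vec n" using fx w D by auto
  \<comment> \<open>\<open>p\<close> is w \<otimes> a, on which f(y) acts through f(x).
    \<open>q\<close> is w \<otimes> (-b1, b0); as b^T annihilates (-b1, b0), all components of y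
    kill \<open>q\<close>.\<close>
  define p where "p = interleave (a0 \<cdot>\<^sub>v w) (a1 \<cdot>\<^sub>v w)"
  define q where "q = interleave ((- b1) \<cdot>\<^sub>v w) (b0 \<cdot>\<^sub>v w)"
  have pq: "p \<in> carrier_vec (2 * n)" "q \<in> carrier_vec (2 * n)"
    using w by (auto simp: p_def q_def)
  have "embed_mat n a0 a1 * f x = f y * embed_mat n a0 a1"
    using n kron_rank1_mult_embed[OF _ ab] xi
    by (intro nc_function_intertwine[OF f n x _ yB yl embed_mat_carrier]) auto
  then have "f y *\<^sub>v (embed_mat n a0 a1 *\<^sub>v w) = embed_mat n a0 a1 *\<^sub>v (f x *\<^sub>v w)"
    using assoc_mult_mat_vec[OF fy embed_mat_carrier w]
      assoc_mult_mat_vec[OF embed_mat_carrier fx w] by metis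
  then have fp: "f y *\<^sub>v p = interleave (a0 \<cdot>\<^sub>v (f x *\<^sub>v w)) (a1 \<cdot>\<^sub>v (f x *\<^sub>v w))"
    using w fx by (simp add: embed_mat_mult_vec p_def)
  have "y ! i *\<^sub>v q = 0\<^sub>v (2 * n)" if i: "i < d" for i
  proof -
    have "b0 \<cdot>\<^sub>v ((- b1) \<cdot>\<^sub>v w) + b1 \<cdot>\<^sub>v (b0 \<cdot>\<^sub>v w) = 0\<^sub>v n"
      using w by auto
    moreover have "x ! i *\<^sub>v 0\<^sub>v n = 0\<^sub>v n"
      using xi[OF i] by auto
    ultimately show ?thesis
      unfolding q_def xi(2)[OF i] using w
      by (subst kron_rank1_mult_vec[OF xi(1)[OF i]]) (auto simp: interleave_def)
  qed
  then have fq: "f y *\<^sub>v q = c \<cdot>\<^sub>v q"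
    unfolding c using n yB yl pq by (intro nc_function_on_kernel[OF f z]) auto
  \<comment> \<open>In C^2, (0, 1) = b1 a + a0 (-b1, b0): the first coordinates cancel and the
    second give a1 b1 + a0 b0 = 1.\<close>
  have e: "interleave (0\<^sub>v n) w = b1 \<cdot>\<^sub>v p + a0 \<cdot>\<^sub>v q"
  proof (rule eq_vecI)
    fix i assume "i < dim_vec (b1 \<cdot>\<^sub>v p + a0 \<cdot>\<^sub>v q)"
    then have i: "i < 2 * n" "i div 2 < n" using pq by auto
    have "b1 * (a1 * t) + a0 * (b0 * t) = t" for t
      using arg_cong[OF ab, of "\<lambda>s. s * t"] by (simp add: algebra_simps)
    then show "interleave (0\<^sub>v n) w $ i = (b1 \<cdot>\<^sub>v p + a0 \<cdot>\<^sub>v q) $ i"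
      using i w by (auto simp: interleave_def p_def q_def)
  qed (use pq in \<open>auto simp: interleave_def\<close>)
  have "f y *\<^sub>v interleave (0\<^sub>v n) w = b1 \<cdot>\<^sub>v (f y *\<^sub>v p) + a0 \<cdot>\<^sub>v (f y *\<^sub>v q)"
    unfolding e using fy pq by (simp add: mult_add_distrib_mat_vec[OF fy] mult_mat_vec[OF fy])
  \<comment> \<open>Substitute f(x) w = D + c w. In the first slot the multiples of c w cancel; in
    the second they add up to c w, again by b^T a = 1.\<close>
  also have "\<dots> = interleave ((a0 * b1) \<cdot>\<^sub>v D) (c \<cdot>\<^sub>v w + (a1 * b1) \<cdot>\<^sub>v D)"
  proof (rule eq_vecI)
    fix i assume "i < dim_vec (interleave ((a0 * b1) \<cdot>\<^sub>v D) (c \<cdot>\<^sub>v w + (a1 * b1) \<cdot>\<^sub>v D))"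
    then have i: "i < 2 * n" "i div 2 < n" using D' by (auto simp: interleave_def)
    have "a0 * (b0 * (c * w $ (i div 2))) + a1 * (b1 * (c * w $ (i div 2))) = c * w $ (i div 2)"
      using arg_cong[OF ab, of "\<lambda>s. s * (c * w $ (i div 2))"] by (simp add: distrib_right mult.assoc)
    then show "(b1 \<cdot>\<^sub>v (f y *\<^sub>v p) + a0 \<cdot>\<^sub>v (f y *\<^sub>v q)) $ i
        = interleave ((a0 * b1) \<cdot>\<^sub>v D) (c \<cdot>\<^sub>v w + (a1 * b1) \<cdot>\<^sub>v D) $ i"
      unfolding fp fq using i w fx D D' pq
      by (cases "even i") (simp_all add: interleave_def q_def algebra_simps)
  qed (use fx fy D' pq in \<open>auto simp: interleave_def\<close>)
  finally have fe: "f y *\<^sub>v interleave (0\<^sub>v n) w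
    = interleave ((a0 * b1) \<cdot>\<^sub>v D) (c \<cdot>\<^sub>v w + (a1 * b1) \<cdot>\<^sub>v D)" .
  have "vec_norm2 (interleave (0\<^sub>v n) w) = vec_norm2 w"
  proof -
    have "(vec_norm2 (interleave (0\<^sub>v n) w))\<^sup>2 = (vec_norm2 w)\<^sup>2"
      using vec_norm2_interleave[of "0\<^sub>v n" n w] w by simp
    then show ?thesis by (simp add: power2_eq_iff_nonneg)
  qed
  then have "vec_norm2 (f y *\<^sub>v interleave (0\<^sub>v n) w) \<le> op_norm (f y) * vec_norm2 w"
    using vec_norm2_mult_mat_vec_le[of "interleave (0\<^sub>v n) w" "f y"] fy by auto
  also have "\<dots> \<le> M * vec_norm2 w"
    using M by (intro mult_right_mono) (auto simp: y_def)
  finally have "(vec_norm2 (f y *\<^sub>v interleave (0\<^sub>v n) w))\<^sup>2 \<le> (M * vec_norm2 w)\<^sup>2"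
    by (intro power_mono) auto
  moreover have "(vec_norm2 (f y *\<^sub>v interleave (0\<^sub>v n) w))\<^sup>2
    = (vec_norm2 ((a0 * b1) \<cdot>\<^sub>v D))\<^sup>2 + (vec_norm2 (c \<cdot>\<^sub>v w + (a1 * b1) \<cdot>\<^sub>v D))\<^sup>2"
    unfolding fe using D' w by (intro vec_norm2_interleave) auto
  ultimately show ?thesis
    by (simp add: vec_norm2_smult)
qed

section \<open>Levels of points and the maximum principle\<close>

text \<open>The first matrix of the list fixes the level. For \<open>d = 0\<close> the empty list
  would belong to every level.\<close>

lemma nc_level_unique:
  assumes "d \<ge> 1" "x \<in> nc_level d n" "x \<in> nc_level d m"
  shows "n = m"
proof -
  have "x ! 0 \<in> set x" using assms by (auto simp: nc_level_def)
  then have "x ! 0 \<in> carrier_mat n n" "x ! 0 \<in> carrier_mat m m"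
    using assms unfolding nc_level_def by blast+
  then show ?thesis by (metis carrier_matD(1))
qed

lemma B_delta_iff:
  assumes "d \<ge> 1" "n \<ge> 1" "x \<in> nc_level d n"
  shows "x \<in> B_delta d \<delta> \<longleftrightarrow> op_norm (eval_poly_mat n \<delta> x) < 1"
proof
  assume "x \<in> B_delta d \<delta>"
  then obtain m where "x \<in> nc_level d m" "op_norm (eval_poly_mat m \<delta> x) < 1"
    by (auto simp: B_delta_def)
  then show "op_norm (eval_poly_mat n \<delta> x) < 1"
    using nc_level_unique[OF assms(1,3)] by simp
qed (use assms in \<open>auto simp: B_delta_def\<close>)

theorem theorem3p3:
  fixes d s r :: nat
    and \<delta> :: "free_poly mat"
    and f :: "complex mat list \<Rightarrow> complex mat"
    and x0 :: "complex mat list"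
  assumes "d \<ge> 1"
    and "\<delta> \<in> carrier_mat s r"
    and "elements_mat \<delta> \<subseteq> free_polys d"
    and "\<And>n. n \<ge> 1 \<Longrightarrow> eval_poly_mat n \<delta> (zero_tuple d n) = 0\<^sub>m (s * n) (r * n)"
    and "nc_function d (B_delta d \<delta>) f"
    and "x0 \<in> B_delta d \<delta>"
    and "\<And>x. x \<in> B_delta d \<delta> \<Longrightarrow> op_norm (f x0) \<ge> op_norm (f x)"
  shows "\<exists>c::complex. \<forall>n\<ge>1. \<forall>x \<in> B_delta d \<delta> \<inter> nc_level d n. f x = c \<cdot>\<^sub>m 1\<^sub>m n"
proof -
  note d = assms(1) and \<delta> = assms(2,3) and f = assms(5)
  define M where "M = op_norm (f x0)"
  have M: "op_norm (f x) \<le> M" if "x \<in> B_delta d \<delta>" for x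
    using assms(7)[OF that] by (simp add: M_def)
  define c where "c = f (zero_tuple d 1) $$ (0, 0)"
  have zl: "zero_tuple d 1 \<in> nc_level d 1"
    by (auto simp: zero_tuple_def nc_level_def)
  have z: "zero_tuple d 1 \<in> B_delta d \<delta>"
    using B_delta_iff[OF d _ zl] assms(4)[of 1] by simp
  have \<delta>0: "Poly_Mapping.lookup (\<delta> $$ (i, j)) [] = 0" if "i < dim_row \<delta>" "j < dim_col \<delta>" for i j
  proof -
    have "\<delta> $$ (i, j) \<in> free_polys d"
      using that \<delta> by blast
    then have "Poly_Mapping.lookup (\<delta> $$ (i, j)) [] = eval_poly_mat 1 \<delta> (zero_tuple d 1) $$ (i, j)"
      using that by (simp add: eval_poly_zero_tuple[simplified] eval_poly_mat_def)
    then show ?thesis using that \<delta> assms(4)[of 1] by simp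
  qed
  have dilate: "map (kron_rank1 a0 a1 b0 b1) x \<in> B_delta d \<delta>"
    if "n \<ge> 1" "x \<in> nc_level d n" "a0 * b0 + a1 * b1 = 1"
      "sqrt (((cmod a0)\<^sup>2 + (cmod a1)\<^sup>2) * ((cmod b0)\<^sup>2 + (cmod b1)\<^sup>2))
        * op_norm (eval_poly_mat n \<delta> x) < 1"
    for n x a0 a1 b0 b1
    using that op_norm_kron_rank1[of a0 a1 b0 b1 "eval_poly_mat n \<delta> x"] kron_rank1_in_nc_level
    by (subst B_delta_iff[OF d, of "2 * n"]) (auto simp: eval_poly_mat_kron_rank1[OF _ _ \<delta>(2) \<delta>0])
  \<comment> \<open>Both idempotents used below have |a| |b| = sqrt (1 + \<epsilon>^2), so this
    provides the size condition of \<open>dilate\<close>.\<close>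
  have small: "\<exists>\<epsilon>>0. sqrt (1 + \<epsilon>\<^sup>2) * op_norm (eval_poly_mat n \<delta> x) < 1"
    if "n \<ge> 1" "x \<in> B_delta d \<delta>" "x \<in> nc_level d n" for n x
  proof -
    define \<rho> where "\<rho> = op_norm (eval_poly_mat n \<delta> x)"
    have \<rho>: "0 \<le> \<rho>" "\<rho> < 1" using that B_delta_iff[OF d that(1,3)] by (auto simp: \<rho>_def)
    \<comment> \<open>Half of the gap to 1: (1 + \<epsilon>) \<rho> \<le> \<rho> + \<epsilon> = (1 +
      \<rho>) / 2 < 1.\<close>
    define \<epsilon> where "\<epsilon> = (1 - \<rho>) / 2"
    have \<epsilon>: "\<epsilon> > 0" using \<rho> by (simp add: \<epsilon>_def)
    have "sqrt (1 + \<epsilon>\<^sup>2) \<le> 1 + \<epsilon>"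
      using \<epsilon> by (intro real_le_lsqrt) (auto simp: power2_eq_square algebra_simps)
    then have "sqrt (1 + \<epsilon>\<^sup>2) * \<rho> \<le> (1 + \<epsilon>) * \<rho>" using \<rho> by (intro mult_right_mono)
    also have "\<dots> \<le> \<rho> + \<epsilon>" using \<rho> \<epsilon> by (simp add: algebra_simps mult_left_le)
    also have "\<dots> < 1" using \<rho> by (simp add: \<epsilon>_def field_simps)
    finally show ?thesis using \<epsilon> \<rho>_def by blast
  qed
  have cM: "cmod c = M"
  proof (rule ccontr)
    assume neq: "cmod c \<noteq> M"
    have "cmod c \<le> M"
    proof -
      have fz: "f (zero_tuple d 1) \<in> carrier_mat 1 1"
        using nc_function_carrier[OF f _ z zl] by simp
      \<comment> \<open>f(0) at level 1 is the 1 x 1 matrix c, so testing it on a unit vector gives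
        |c| \<le> M.\<close>
      define e :: "complex vec" where "e = unit_vec 1 0"
      have e: "e \<in> carrier_vec 1" "vec_norm2 e = 1"
        by (auto simp: e_def vec_norm2_def L2_set_def)
      have "zero_tuple d 1 ! i *\<^sub>v e = 0\<^sub>v 1" if "i < d" for i
        using that e by (auto simp: zero_tuple_def)
      then have "f (zero_tuple d 1) *\<^sub>v e = c \<cdot>\<^sub>v e"
        unfolding c_def by (intro nc_function_on_kernel[OF f z _ z zl e(1)]) auto
      then have "cmod c \<le> op_norm (f (zero_tuple d 1))"
        using vec_norm2_mult_mat_vec_le[of e "f (zero_tuple d 1)"] e fz by (auto simp: vec_norm2_smult)
      then show ?thesis using M[OF z] by simp
    qed
    with neq have lt: "cmod c < M" by simp
    obtain n where n: "n \<ge> 1" and x: "x0 \<in> nc_level d n"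
      using assms(6) by (auto simp: B_delta_def)
    obtain \<epsilon> where \<epsilon>: "\<epsilon> > 0" "sqrt (1 + \<epsilon>\<^sup>2) * op_norm (eval_poly_mat n \<delta> x0) < 1"
      using small[OF n assms(6) x] by blast
    have fx: "f x0 \<in> carrier_mat n n"
      by (rule nc_function_carrier[OF f n assms(6) x])
    \<comment> \<open>Here a = (\<epsilon>, 1) and b = (0, 1), so a0 b1 = \<epsilon> and a1 b1 = 1.
      The second vector in the general bound becomes c w + D = f(x0) w.\<close>
    have y: "map (kron_rank1 (of_real \<epsilon>) 1 0 1) x0 \<in> B_delta d \<delta>"
      using \<epsilon> by (intro dilate[OF n x]) (auto simp: add.commute)
    define m where "m = (M + cmod c) / 2"
    have m: "cmod c < m" "m < M" "0 \<le> m" using lt op_norm_nonneg[of "f x0"] by (auto simp: m_def M_def)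
    \<comment> \<open>\<open>K\<close> will bound |f(x0) w| on the whole unit ball, so no maximising
      vector is needed. If |f(x0) w| exceeds the midpoint \<open>m\<close>, then |D| \<ge> m - |c|,
      and the \<epsilon>-term forces a definite loss below M^2. As \<open>sqrt\<close> is strictly
      increasing on all reals, the sign of the radicand does not matter.\<close>
    define K where "K = max m (sqrt (M\<^sup>2 - (\<epsilon> * (m - cmod c))\<^sup>2))"
    have "sqrt (M\<^sup>2 - (\<epsilon> * (m - cmod c))\<^sup>2) < sqrt (M\<^sup>2)"
      using \<epsilon> m by (simp only: real_sqrt_less_iff) simp
    then have KM: "K < M" using m by (simp add: K_def)
    have "op_norm (f x0) \<le> K"
    proof (rule op_norm_least)
      fix w assume "w \<in> carrier_vec (dim_col (f x0))" and w1: "vec_norm2 w \<le> 1"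
      then have w: "w \<in> carrier_vec n" using fx by auto
      define D where "D = f x0 *\<^sub>v w - c \<cdot>\<^sub>v w"
      have fw: "f x0 *\<^sub>v w = c \<cdot>\<^sub>v w + 1 \<cdot>\<^sub>v D"
        using fx w by (auto simp: D_def)
      show "vec_norm2 (f x0 *\<^sub>v w) \<le> K"
      proof (cases "vec_norm2 (f x0 *\<^sub>v w) \<le> m")
        case False
        have "vec_norm2 (f x0 *\<^sub>v w) \<le> vec_norm2 (c \<cdot>\<^sub>v w) + vec_norm2 D"
          unfolding fw using w fx vec_norm2_triangle[of "c \<cdot>\<^sub>v w" n D] by (auto simp: D_def)
        also have "vec_norm2 (c \<cdot>\<^sub>v w) \<le> cmod c"
          using w1 by (simp add: vec_norm2_smult mult_left_le)
        finally have "m - cmod c \<le> vec_norm2 D" using False by simp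
        then have "(\<epsilon> * (m - cmod c))\<^sup>2 \<le> (\<epsilon> * vec_norm2 D)\<^sup>2"
          using \<epsilon> m by (intro power_mono mult_left_mono) auto
        moreover have "(\<epsilon> * vec_norm2 D)\<^sup>2 + (vec_norm2 (f x0 *\<^sub>v w))\<^sup>2 \<le> (M * vec_norm2 w)\<^sup>2"
          using nc_function_kron_rank1_bound[OF f z n assms(6) x _ y M[OF y] w c_def D_def] fw \<epsilon>
          by simp
        moreover have "(M * vec_norm2 w)\<^sup>2 \<le> M\<^sup>2"
          using w1 m by (intro power_mono) (auto simp: mult_left_le)
        ultimately have "(vec_norm2 (f x0 *\<^sub>v w))\<^sup>2 \<le> M\<^sup>2 - (\<epsilon> * (m - cmod c))\<^sup>2" by simp
        then show ?thesis unfolding K_def by (simp add: real_le_rsqrt le_max_iff_disj)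
      qed (simp add: K_def)
    qed
    then show False using KM by (simp add: M_def)
  qed
  have "f x = c \<cdot>\<^sub>m 1\<^sub>m n" if n: "n \<ge> 1" and x: "x \<in> B_delta d \<delta>" "x \<in> nc_level d n" for n x
  proof (rule eq_mat_by_vec)
    show fx: "f x \<in> carrier_mat n n" by (rule nc_function_carrier[OF f n x])
    obtain \<epsilon> where \<epsilon>: "\<epsilon> > 0" "sqrt (1 + \<epsilon>\<^sup>2) * op_norm (eval_poly_mat n \<delta> x) < 1"
      using small[OF n x] by blast
    \<comment> \<open>Now a = (1, 0) and b = (1, \<epsilon>), so a0 b1 = \<epsilon> and a1 b1 = 0:
      only c w is left in the second vector.\<close>
    have y: "map (kron_rank1 1 0 1 (of_real \<epsilon>)) x \<in> B_delta d \<delta>"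
      using \<epsilon> by (intro dilate[OF n x(2)]) auto
    fix w :: "complex vec" assume w: "w \<in> carrier_vec n"
    define D where "D = f x *\<^sub>v w - c \<cdot>\<^sub>v w"
    have D: "D \<in> carrier_vec n" using fx w by (auto simp: D_def)
    have eq: "c \<cdot>\<^sub>v w + 0 \<cdot>\<^sub>v D = c \<cdot>\<^sub>v w" using w D by auto
    have "(\<epsilon> * vec_norm2 D)\<^sup>2 + (vec_norm2 (c \<cdot>\<^sub>v w))\<^sup>2 \<le> (M * vec_norm2 w)\<^sup>2"
      using nc_function_kron_rank1_bound[OF f z n x _ y M[OF y] w c_def D_def] eq \<epsilon> by simp
    \<comment> \<open>By |c| = M the term |c w|^2 already exhausts the right-hand side.\<close>
    then have "(\<epsilon> * vec_norm2 D)\<^sup>2 \<le> 0"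
      by (simp add: vec_norm2_smult cM)
    then have "vec_norm2 D = 0" using \<epsilon> by simp
    then have D0: "D = 0\<^sub>v n" by (rule vec_norm2_eq_0D[OF D])
    have "f x *\<^sub>v w = c \<cdot>\<^sub>v w + D" using fx w by (auto simp: D_def)
    also have "\<dots> = (c \<cdot>\<^sub>m 1\<^sub>m n) *\<^sub>v w"
      using w D0 by (intro eq_vecI) auto
    finally show "f x *\<^sub>v w = (c \<cdot>\<^sub>m 1\<^sub>m n) *\<^sub>v w" .
  qed simp
  then show ?thesis by blast
qed

end
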